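(* Let $X$ be a nonempty compact metric space, let $G$ be a group acting on $X$ by homeomorphisms, and let $\mathcal U$ be an open cover of $X$ consisting of pairwise disjoint sets. Then the function $F\mapsto H_{\mathsf{top}}(\mathcal U^F)$ on $\mathcal F(G)$ satisfies Shearer's inequality: for every $F\in\mathcal F(G)$, every integer $k\ge1$ and every $k$-cover $\mathcal K$ of $F$, $$H_{\mathsf{top}}(\mathcal U^F)\le\frac1k\sum_{K\in\mathcal K}H_{\mathsf{top}}(\mathcal U^K).$$
   Context: $\mathcal F(G)$ denotes the collection of all nonempty finite subsets of $G$. For an integer $k\ge 1$, a $k$-cover of $F\in\mathcal F(G)$ is a finite family $\mathcal K=\{K_1,\dots,K_r\}$ of elements of $\mathcal F(G)$, with possible repetitions, such that each element of $F$ belongs to $K_i$ for at least $k$ indices $i$; sums over $K\in\mathcal K$ are over the indices $i$ (repeated terms counted separately). For an open cover $\mathcal U$ of $X$ and $f\in G$ put $f^{-1}\mathcal U=\{f^{-1}U:U\in\mathcal U\}$, and for $F\in\mathcal F(G)$ put $\mathcal U^F=\bigvee_{f\in F}f^{-1}\mathcal U$, where the join $\mathcal U\vee\mathcal V=\{U\cap V:U\in\mathcal U,V\in\mathcal V\}$. $N(\mathcal U)$ is the smallest cardinality of a subcover of $\mathcal U$, and $H_{\mathsf{top}}(\mathcal U)=\log N(\mathcal U)$. *)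

theory Defs
  imports "HOL-Analysis.Analysis" "HOL-Algebra.Group_Action"
begin

definition finite_subsets :: "('g, 'm) monoid_scheme \<Rightarrow> 'g set set" where
  "finite_subsets G = {F. F \<subseteq> carrier G \<and> finite F \<and> F \<noteq> {}}"

text \<open>The family \<open>K\<^sub>1, \<dots>, K\<^sub>r\<close> is a list, so repetitions are allowed and are
  counted with multiplicity.\<close>

definition k_cover :: "('g, 'm) monoid_scheme \<Rightarrow> nat \<Rightarrow> 'g set \<Rightarrow> 'g set list \<Rightarrow> bool" where
  "k_cover G k F Ks \<longleftrightarrow> set Ks \<subseteq> finite_subsets G \<and>
     (\<forall>f\<in>F. k \<le> card {i. i < length Ks \<and> f \<in> Ks ! i})"

definition open_cover :: "'x topology \<Rightarrow> 'x set set \<Rightarrow> bool" where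
  "open_cover T \<U> \<longleftrightarrow> (\<forall>U\<in>\<U>. openin T U) \<and> \<Union>\<U> = topspace T"

definition preimage_cover :: "'x set \<Rightarrow> ('x \<Rightarrow> 'x) \<Rightarrow> 'x set set \<Rightarrow> 'x set set" where
  "preimage_cover X t \<U> = (\<lambda>U. t -` U \<inter> X) ` \<U>"

definition cover_join :: "'x set set \<Rightarrow> 'x set set \<Rightarrow> 'x set set" where
  "cover_join \<U> \<V> = {U \<inter> V | U V. U \<in> \<U> \<and> V \<in> \<V>}"

text \<open>The join of a family of covers over a nonempty finite index set consists of all intersections
  obtained by choosing one member of each cover; the lemmas \<open>Join_singleton\<close> and
  \<open>Join_insert\<close> identify it with the iterated binary join.\<close>

definition Join :: "'i set \<Rightarrow> ('i \<Rightarrow> 'x set set) \<Rightarrow> 'x set set" where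
  "Join I \<C> = {\<Inter>i\<in>I. W i | W. \<forall>i\<in>I. W i \<in> \<C> i}"

lemma Join_singleton: "Join {i} \<C> = \<C> i"
  unfolding Join_def by auto

lemma Join_insert:
  assumes "i \<notin> I"
  shows "Join (insert i I) \<C> = cover_join (\<C> i) (Join I \<C>)"
proof (intro equalityI subsetI)
  fix A assume "A \<in> Join (insert i I) \<C>"
  then show "A \<in> cover_join (\<C> i) (Join I \<C>)"
    unfolding Join_def cover_join_def by auto
next
  fix A assume "A \<in> cover_join (\<C> i) (Join I \<C>)"
  then obtain U W where "A = U \<inter> (\<Inter>j\<in>I. W j)" "U \<in> \<C> i" "\<forall>j\<in>I. W j \<in> \<C> j"
    unfolding Join_def cover_join_def by auto
  moreover have "(\<Inter>j\<in>I. (W(i := U)) j) = (\<Inter>j\<in>I. W j)"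
    using assms by (intro INF_cong) auto
  ultimately have "A = (\<Inter>j\<in>insert i I. (W(i := U)) j)"
      "\<forall>j\<in>insert i I. (W(i := U)) j \<in> \<C> j"
    using assms by auto
  then show "A \<in> Join (insert i I) \<C>"
    unfolding Join_def by blast
qed

definition cover_power ::
  "'x set \<Rightarrow> ('g \<Rightarrow> 'x \<Rightarrow> 'x) \<Rightarrow> 'x set set \<Rightarrow> 'g set \<Rightarrow> 'x set set" where
  "cover_power X \<phi> \<U> F = Join F (\<lambda>f. preimage_cover X (\<phi> f) \<U>)"

text \<open>Only finite subcovers are considered, because \<^const>\<open>card\<close> is 0 on infinite sets. For an
  open cover of a compact space a finite subcover exists, so the minimum is attained.\<close>

definition min_subcover :: "'x set \<Rightarrow> 'x set set \<Rightarrow> nat" where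
  "min_subcover X \<U> = (LEAST n. \<exists>\<V>\<subseteq>\<U>. finite \<V> \<and> \<Union>\<V> = X \<and> card \<V> = n)"

definition H_top :: "'x set \<Rightarrow> 'x set set \<Rightarrow> real" where
  "H_top X \<U> = ln (real (min_subcover X \<U>))"

end

theory Submission
  imports Defs
begin

text \<open>Label each point by the member of the cover containing it. The labels of the translates
  of \<open>x\<close> by the elements of \<open>F\<close> form a pattern on \<open>F\<close>; since the cover is disjoint, the nonempty
  members of \<open>\<U>\<^sup>F\<close> correspond to the patterns that occur, and none of them can be omitted from a
  subcover. So the claim is Shearer's inequality for the number of restrictions of a finite set of
  functions. This follows by induction on \<open>F\<close>: split the functions by their value at the new
  element, apply the induction hypothesis to each part, and recombine by Hoelder's inequality.\<close>

section \<open>A Hoelder inequality\<close>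

text \<open>Hoelder's inequality with all exponents equal to \<open>1 / k\<close>, whose total
  \<open>card I / k\<close> may exceed 1. Once each \<open>x i\<close> is scaled to total mass 1, it
  reduces to the arithmetic-geometric mean inequality at each point of \<open>A\<close>.\<close>

lemma sum_prod_powr_le:
  fixes x :: "'i \<Rightarrow> 'a \<Rightarrow> real"
  assumes "finite A" "finite I" "1 \<le> k" "k \<le> card I"
    and pos: "\<And>i a. i \<in> I \<Longrightarrow> a \<in> A \<Longrightarrow> 0 < x i a"
  shows "(\<Sum>a\<in>A. \<Prod>i\<in>I. x i a powr (1 / k)) \<le> (\<Prod>i\<in>I. (\<Sum>a\<in>A. x i a) powr (1 / k))"
proof (cases "A = {}")
  case True
  then show ?thesis by (simp add: prod_nonneg)
next
  case False
  define S where "S i = (\<Sum>a\<in>A. x i a)" for i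
  define y where "y i a = x i a / S i" for i a
  have I: "I \<noteq> {}"
    using assms by auto
  have S_pos: "0 < S i" if "i \<in> I" for i
    unfolding S_def using that assms False by (intro sum_pos) auto
  have y_pos: "0 < y i a" if "i \<in> I" "a \<in> A" for i a
    unfolding y_def using that S_pos pos by simp
  have y_le: "y i a \<le> 1" if "i \<in> I" "a \<in> A" for i a
  proof -
    have "x i a \<le> S i"
      unfolding S_def using that \<open>finite A\<close> pos by (intro member_le_sum) (auto intro: less_imp_le)
    then show ?thesis
      unfolding y_def using that S_pos by simp
  qed
  have y_sum: "(\<Sum>a\<in>A. y i a) = 1" if "i \<in> I" for i
    using S_pos[OF that] unfolding y_def by (simp add: S_def flip: sum_divide_distrib)
  have y_prod: "(\<Prod>i\<in>I. y i a powr (1 / k)) \<le> (\<Sum>i\<in>I. y i a / card I)" if "a \<in> A" for a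
  proof -
    have "(\<Prod>i\<in>I. y i a powr (1 / k)) = (\<Prod>i\<in>I. y i a) powr (1 / k)"
      by (rule prod_powr_distrib [symmetric])
    \<comment> \<open>The normalised values are at most 1, so lowering the exponent from
      \<open>1 / k\<close> to \<open>1 / card I\<close> can only increase the product; this absorbs
      the excess of the exponents.\<close>
    also have "\<dots> \<le> (\<Prod>i\<in>I. y i a) powr (1 / card I)"
    proof (rule powr_mono')
      show "1 / real (card I) \<le> 1 / real k"
        using assms by (simp add: frac_le)
      show "0 \<le> (\<Prod>i\<in>I. y i a)"
        using y_pos that by (intro prod_nonneg) (auto intro: less_imp_le)
      show "(\<Prod>i\<in>I. y i a) \<le> 1"
        using y_pos y_le that by (intro prod_le_1) (auto intro: less_imp_le)
    qed
    also have "\<dots> \<le> (\<Sum>i\<in>I. y i a / card I)"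
      using y_pos that \<open>finite I\<close> I by (intro arith_geom_mean) (auto intro: less_imp_le)
    finally show ?thesis .
  qed
  have x_eq: "x i a powr (1 / k) = S i powr (1 / k) * y i a powr (1 / k)"
    if "i \<in> I" "a \<in> A" for i a
  proof -
    have "x i a = S i * y i a"
      using S_pos[OF that(1)] by (simp add: y_def)
    then show ?thesis
      using S_pos y_pos that by (simp add: powr_mult)
  qed
  have "(\<Sum>a\<in>A. \<Prod>i\<in>I. x i a powr (1 / k))
      = (\<Sum>a\<in>A. (\<Prod>i\<in>I. S i powr (1 / k)) * (\<Prod>i\<in>I. y i a powr (1 / k)))"
    using x_eq by (simp add: prod.distrib)
  also have "\<dots> = (\<Prod>i\<in>I. S i powr (1 / k)) * (\<Sum>a\<in>A. \<Prod>i\<in>I. y i a powr (1 / k))"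
    by (simp add: sum_distrib_left)
  also have "\<dots> \<le> (\<Prod>i\<in>I. S i powr (1 / k)) * (\<Sum>a\<in>A. \<Sum>i\<in>I. y i a / card I)"
    using y_prod by (intro mult_left_mono sum_mono prod_nonneg) auto
  also have "(\<Sum>a\<in>A. \<Sum>i\<in>I. y i a / card I) = (\<Sum>i\<in>I. (\<Sum>a\<in>A. y i a) / card I)"
    by (subst sum.swap) (simp add: sum_divide_distrib)
  also have "\<dots> = 1"
    using y_sum I \<open>finite I\<close> by simp
  finally show ?thesis
    by (simp add: S_def)
qed

section \<open>Shearer's inequality for finite sets of functions\<close>

text \<open>The size of the projection of \<open>P\<close> to the coordinates in \<open>K\<close>:
  \<open>restrict\<close> puts \<open>undefined\<close> off \<open>K\<close>, so functions agreeing
  on \<open>K\<close> count once.\<close>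

definition num_restrictions :: "('g \<Rightarrow> 'c) set \<Rightarrow> 'g set \<Rightarrow> nat" where
  "num_restrictions P K = card ((\<lambda>q. restrict q K) ` P)"

lemma num_restrictions_pos:
  assumes "finite P" "P \<noteq> {}"
  shows "0 < num_restrictions P K"
  using assms by (simp add: num_restrictions_def card_gt_0_iff)

lemma num_restrictions_mono:
  assumes "finite P" "Q \<subseteq> P"
  shows "num_restrictions Q K \<le> num_restrictions P K"
  unfolding num_restrictions_def using assms by (intro card_mono) auto

text \<open>Since \<open>f\<close> lies in \<open>K\<close>, restrictions coming from different
  fibres still differ at \<open>f\<close>, so the fibres have disjoint images.\<close>

lemma num_restrictions_split:
  assumes "finite P" "f \<in> K"
  shows "num_restrictions P K = (\<Sum>a\<in>(\<lambda>q. q f) ` P. num_restrictions {q \<in> P. q f = a} K)"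
proof -
  have "(\<lambda>q. restrict q K) ` P
      = (\<Union>a\<in>(\<lambda>q. q f) ` P. (\<lambda>q. restrict q K) ` {q \<in> P. q f = a})"
    by auto
  moreover have "(\<lambda>q. restrict q K) ` {q \<in> P. q f = a} \<inter> (\<lambda>q. restrict q K) ` {q \<in> P. q f = b} = {}"
    if "a \<noteq> b" for a b
    using that \<open>f \<in> K\<close> by (auto dest!: fun_cong[where x = f])
  ultimately show ?thesis
    unfolding num_restrictions_def using \<open>finite P\<close> by (simp only:) (subst card_UN_disjoint; simp)
qed

text \<open>On a fibre the value at \<open>f\<close> is the constant \<open>a\<close>, so the
  restriction to \<open>F\<close> determines the one to \<open>insert f F\<close>.\<close>

lemma num_restrictions_insert_fiber:
  assumes "finite P"
  shows "num_restrictions {q \<in> P. q f = a} (insert f F) \<le> num_restrictions {q \<in> P. q f = a} F"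
proof -
  have "(\<lambda>q. restrict q (insert f F)) ` {q \<in> P. q f = a}
      = (\<lambda>r. r(f := a)) ` (\<lambda>q. restrict q F) ` {q \<in> P. q f = a}"
    unfolding image_image by (intro image_cong refl) (auto simp: restrict_def fun_eq_iff)
  then show ?thesis
    unfolding num_restrictions_def using assms by (simp add: card_image_le)
qed

text \<open>\<open>P\<close> varies in the induction because the hypothesis is applied to its
  fibres. Factors with \<open>f \<in> K i\<close> are additive over the fibres and go through
  Hoelder; the others are bounded by monotonicity.\<close>

lemma Shearer_num_restrictions:
  fixes K :: "'i \<Rightarrow> 'g set" and P :: "('g \<Rightarrow> 'c) set"
  assumes "finite F" "finite J" "1 \<le> k" "finite P" "P \<noteq> {}"
    and "\<And>f. f \<in> F \<Longrightarrow> k \<le> card {i \<in> J. f \<in> K i}"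
  shows "real (num_restrictions P F) \<le> (\<Prod>i\<in>J. real (num_restrictions P (K i)) powr (1 / k))"
  using assms
proof (induction F arbitrary: P rule: finite_induct)
  case empty
  \<comment> \<open>With no coordinates all functions collapse to one, while every factor on the
    right is at least 1 because \<open>P\<close> is nonempty.\<close>
  have "(\<lambda>q. restrict q {}) ` P = {\<lambda>_. undefined}"
    using \<open>P \<noteq> {}\<close> by (auto simp: image_iff restrict_def)
  then have "real (num_restrictions P {}) = 1"
    by (simp add: num_restrictions_def)
  also have "\<dots> \<le> (\<Prod>i\<in>J. real (num_restrictions P (K i)) powr (1 / k))"
    using num_restrictions_pos[OF \<open>finite P\<close> \<open>P \<noteq> {}\<close>]
    by (intro prod_ge_1 ge_one_powr_ge_zero) (simp_all add: Suc_leI)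
  finally show ?case .
next
  case (insert f F)
  define A where "A = (\<lambda>q. q f) ` P"
  define Q where "Q a = {q \<in> P. q f = a}" for a
  \<comment> \<open>The covering condition at the new element \<open>f\<close> gives
    \<open>k \<le> card I\<close>, which is what the Hoelder step requires.\<close>
  define I where "I = {i \<in> J. f \<in> K i}"
  define m where "m R i = real (num_restrictions R (K i)) powr (1 / k)" for R :: "('g \<Rightarrow> 'c) set" and i
  have Q: "Q a \<subseteq> P" "finite (Q a)" for a
    using \<open>finite P\<close> by (auto simp: Q_def)
  have Q_ne: "Q a \<noteq> {}" if "a \<in> A" for a
    using that by (auto simp: A_def Q_def)
  have I: "finite I" "I \<subseteq> J" "k \<le> card I"
    using insert.prems by (auto simp: I_def)
  have m_nonneg: "0 \<le> m R i" for R i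
    by (simp add: m_def)
  have IH: "real (num_restrictions (Q a) F) \<le> (\<Prod>i\<in>J. m (Q a) i)" if "a \<in> A" for a
    unfolding m_def using insert.prems Q Q_ne that by (intro insert.IH) auto
  have split: "(\<Prod>i\<in>J. m R i) = (\<Prod>i\<in>J - I. m R i) * (\<Prod>i\<in>I. m R i)" for R
    using I \<open>finite J\<close> by (intro prod.subset_diff) auto
  have "real (num_restrictions P (insert f F)) = (\<Sum>a\<in>A. real (num_restrictions (Q a) (insert f F)))"
    using num_restrictions_split[OF \<open>finite P\<close>, of f "insert f F"] by (simp add: A_def Q_def)
  also have "\<dots> \<le> (\<Sum>a\<in>A. real (num_restrictions (Q a) F))"
    unfolding Q_def using num_restrictions_insert_fiber[OF \<open>finite P\<close>]
    by (intro sum_mono of_nat_mono)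
  also have "\<dots> \<le> (\<Sum>a\<in>A. (\<Prod>i\<in>J - I. m (Q a) i) * (\<Prod>i\<in>I. m (Q a) i))"
    using IH by (intro sum_mono) (simp flip: split)
  \<comment> \<open>Passing from the fibre to \<open>P\<close> for \<open>i\<close> outside
    \<open>I\<close> makes these factors independent of \<open>a\<close>, so they leave the
    sum.\<close>
  also have "\<dots> \<le> (\<Sum>a\<in>A. (\<Prod>i\<in>J - I. m P i) * (\<Prod>i\<in>I. m (Q a) i))"
  proof (intro sum_mono mult_right_mono prod_mono conjI m_nonneg prod_nonneg ballI)
    fix a i
    show "m (Q a) i \<le> m P i"
      unfolding m_def using num_restrictions_mono[OF \<open>finite P\<close> Q(1)]
      by (intro powr_mono2) auto
  qed
  also have "\<dots> = (\<Prod>i\<in>J - I. m P i) * (\<Sum>a\<in>A. \<Prod>i\<in>I. m (Q a) i)"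
    by (simp add: sum_distrib_left)
  also have "\<dots> \<le> (\<Prod>i\<in>J - I. m P i) * (\<Prod>i\<in>I. m P i)"
  proof (rule mult_left_mono)
    have "(\<Sum>a\<in>A. \<Prod>i\<in>I. m (Q a) i)
        \<le> (\<Prod>i\<in>I. (\<Sum>a\<in>A. real (num_restrictions (Q a) (K i))) powr (1 / k))"
      unfolding m_def
      using I insert.prems Q Q_ne by (intro sum_prod_powr_le) (auto simp: A_def num_restrictions_pos)
    also have "\<dots> = (\<Prod>i\<in>I. m P i)"
    proof (rule prod.cong)
      fix i assume "i \<in> I"
      then show "(\<Sum>a\<in>A. real (num_restrictions (Q a) (K i))) powr (1 / k) = m P i"
        using num_restrictions_split[OF \<open>finite P\<close>, of f "K i"]
        by (simp add: m_def I_def A_def Q_def)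
    qed simp
    finally show "(\<Sum>a\<in>A. \<Prod>i\<in>I. m (Q a) i) \<le> (\<Prod>i\<in>I. m P i)" .
    show "0 \<le> (\<Prod>i\<in>J - I. m P i)"
      by (intro prod_nonneg m_nonneg ballI)
  qed
  finally show ?case
    unfolding split[symmetric] by (simp add: m_def)
qed

section \<open>Minimal subcovers of disjoint covers\<close>

lemma min_subcover_disjoint:
  assumes "pairwise disjnt \<C>" "\<Union>\<C> = X" "finite \<C>"
  shows "min_subcover X \<C> = card (\<C> - {{}})"
  unfolding min_subcover_def
proof (rule Least_equality)
  show "\<exists>\<V>\<subseteq>\<C>. finite \<V> \<and> \<Union>\<V> = X \<and> card \<V> = card (\<C> - {{}})"
    using assms by (intro exI[of _ "\<C> - {{}}"]) auto
next
  fix n assume "\<exists>\<V>\<subseteq>\<C>. finite \<V> \<and> \<Union>\<V> = X \<and> card \<V> = n"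
  then obtain \<V> where \<V>: "\<V> \<subseteq> \<C>" "finite \<V>" "\<Union>\<V> = X" "card \<V> = n"
    by blast
  have "\<C> - {{}} \<subseteq> \<V>"
  proof
    fix C assume C: "C \<in> \<C> - {{}}"
    then obtain x where "x \<in> C"
      by auto
    then obtain V where "V \<in> \<V>" "x \<in> V"
      using C assms(2) \<V>(3) by blast
    then have "V = C"
      using \<open>x \<in> C\<close> C \<V>(1) assms(1) by (auto simp: pairwise_def disjnt_def)
    then show "C \<in> \<V>"
      using \<open>V \<in> \<V>\<close> by simp
  qed
  then show "card (\<C> - {{}}) \<le> n"
    using \<V> card_mono by blast
qed

text \<open>Both images are copies of the quotient of \<open>A\<close> by the common kernel;
  \<open>A\<close> itself may be infinite.\<close>

lemma card_image_eq_if_same_kernel: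
  assumes "\<And>x y. x \<in> A \<Longrightarrow> y \<in> A \<Longrightarrow> g x = g y \<longleftrightarrow> h x = h y"
  shows "card (g ` A) = card (h ` A)"
proof -
  \<comment> \<open>\<open>s b\<close> chooses a representative of the fibre of \<open>g\<close>
    over \<open>b\<close>; applying \<open>h\<close> to it gives the bijection.\<close>
  define s where "s b = (SOME x. x \<in> A \<and> g x = b)" for b
  have s: "s (g x) \<in> A \<and> g (s (g x)) = g x" if "x \<in> A" for x
    unfolding s_def using that by (intro someI_ex[of "\<lambda>y. y \<in> A \<and> g y = g x"]) auto
  have "bij_betw (\<lambda>b. h (s b)) (g ` A) (h ` A)"
  proof (rule bij_betw_imageI)
    have hs: "h (s (g x)) = h x" if "x \<in> A" for x
      using s assms that by blast
    show "inj_on (\<lambda>b. h (s b)) (g ` A)"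
      using hs assms by (auto simp: inj_on_def)
    show "(\<lambda>b. h (s b)) ` g ` A = h ` A"
      unfolding image_image using hs by (intro image_cong) auto
  qed
  then show ?thesis
    by (rule bij_betw_same_card)
qed

text \<open>Here \<open>c f x\<close> is the label of \<open>\<phi> f x\<close>. The topological
  count becomes a count of label patterns on \<open>F\<close>, through the sets of points sharing a
  pattern.\<close>

lemma min_subcover_cover_power:
  assumes \<U>: "finite \<U>" "pairwise disjnt \<U>"
    and F: "finite F" "F \<noteq> {}"
    and c: "\<And>f x. f \<in> F \<Longrightarrow> x \<in> X \<Longrightarrow> c f x \<in> \<U> \<and> \<phi> f x \<in> c f x"
  shows "min_subcover X (cover_power X \<phi> \<U> F) = card ((\<lambda>x. \<lambda>f\<in>F. c f x) ` X)"
proof -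
  let ?C = "cover_power X \<phi> \<U> F"
  have c_eq: "U = c f x" if "f \<in> F" "x \<in> X" "U \<in> \<U>" "\<phi> f x \<in> U" for f x U
    using c[OF that(1,2)] that \<U>(2) by (auto simp: pairwise_def disjnt_def)
  define atom where "atom x = {y \<in> X. \<forall>f\<in>F. \<phi> f y \<in> c f x}" for x
  \<comment> \<open>Indexing the join by choice functions in \<open>PiE\<close> makes its finiteness
    evident.\<close>
  have C_eq: "?C = (\<lambda>V. {y \<in> X. \<forall>f\<in>F. \<phi> f y \<in> V f}) ` (PiE F (\<lambda>_. \<U>))"
  proof (intro equalityI subsetI)
    fix A assume "A \<in> ?C"
    then obtain W where W: "A = (\<Inter>f\<in>F. W f)"
        "\<forall>f\<in>F. \<exists>U\<in>\<U>. W f = \<phi> f -` U \<inter> X"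
      by (auto simp: cover_power_def Join_def preimage_cover_def image_iff)
    then obtain V where V: "\<forall>f\<in>F. V f \<in> \<U> \<and> W f = \<phi> f -` V f \<inter> X"
      by metis
    \<comment> \<open>Nonemptiness of \<open>F\<close> matters here and in the converse inclusion:
      an intersection over no indices would be the whole type instead of \<open>X\<close>.\<close>
    have "A = {y \<in> X. \<forall>f\<in>F. \<phi> f y \<in> restrict V F f}"
      using V F by (auto simp: W(1))
    moreover have "restrict V F \<in> PiE F (\<lambda>_. \<U>)"
      using V by auto
    ultimately show "A \<in> (\<lambda>V. {y \<in> X. \<forall>f\<in>F. \<phi> f y \<in> V f}) ` (PiE F (\<lambda>_. \<U>))"
      by blast
  next
    fix A assume "A \<in> (\<lambda>V. {y \<in> X. \<forall>f\<in>F. \<phi> f y \<in> V f}) ` (PiE F (\<lambda>_. \<U>))"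
    then obtain V where V: "V \<in> PiE F (\<lambda>_. \<U>)" and A: "A = {y \<in> X. \<forall>f\<in>F. \<phi> f y \<in> V f}"
      by blast
    have "A = (\<Inter>f\<in>F. \<phi> f -` V f \<inter> X)"
      using F by (auto simp: A)
    then show "A \<in> ?C"
      using V unfolding cover_power_def Join_def preimage_cover_def
      by (auto intro!: exI[of _ "\<lambda>f. \<phi> f -` V f \<inter> X"])
  qed
  \<comment> \<open>A point of a member forces all its labels by disjointness, so any of its points
    determines the member. This yields both disjointness of the join and the description of its
    nonempty members.\<close>
  have atom_C: "A = atom x" if "A \<in> ?C" "x \<in> A" for A x
  proof -
    obtain V where V: "V \<in> PiE F (\<lambda>_. \<U>)" and A: "A = {y \<in> X. \<forall>f\<in>F. \<phi> f y \<in> V f}"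
      using \<open>A \<in> ?C\<close> unfolding C_eq by blast
    have "V f = c f x" if "f \<in> F" for f
      using that V \<open>x \<in> A\<close> unfolding A by (intro c_eq) auto
    then show ?thesis
      by (auto simp: A atom_def)
  qed
  have mem_atom: "x \<in> atom x" if "x \<in> X" for x
    using c that by (simp add: atom_def)
  have atom_in_C: "atom x \<in> ?C" if "x \<in> X" for x
    unfolding C_eq
  proof
    show "atom x = {y \<in> X. \<forall>f\<in>F. \<phi> f y \<in> (\<lambda>f\<in>F. c f x) f}"
      by (auto simp: atom_def)
    show "(\<lambda>f\<in>F. c f x) \<in> PiE F (\<lambda>_. \<U>)"
      using c that by auto
  qed
  have C_sub: "A \<subseteq> X" if "A \<in> ?C" for A
    using that unfolding C_eq by auto
  have "min_subcover X ?C = card (?C - {{}})"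
  proof (rule min_subcover_disjoint)
    show "pairwise disjnt ?C"
      unfolding pairwise_def disjnt_def using atom_C by blast
    show "\<Union>?C = X"
      using C_sub mem_atom atom_in_C by blast
    show "finite ?C"
      unfolding C_eq using \<U> F by (intro finite_imageI finite_PiE)
  qed
  also have "?C - {{}} = atom ` X"
  proof (intro equalityI subsetI)
    fix A assume "A \<in> ?C - {{}}"
    then obtain x where "x \<in> A" "A \<in> ?C"
      by auto
    then show "A \<in> atom ` X"
      using atom_C C_sub by blast
  next
    fix A assume "A \<in> atom ` X"
    then show "A \<in> ?C - {{}}"
      using atom_in_C mem_atom by blast
  qed
  also have "card (atom ` X) = card ((\<lambda>x. \<lambda>f\<in>F. c f x) ` X)"
  proof (rule card_image_eq_if_same_kernel)
    fix x y assume xy: "x \<in> X" "y \<in> X"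
    have "c f x = c f y" if "atom x = atom y" "f \<in> F" for f
    proof -
      have "\<phi> f y \<in> c f x"
        using mem_atom[OF xy(2)] that by (auto simp flip: that(1) simp: atom_def)
      then show ?thesis
        using c c_eq that xy by blast
    qed
    moreover have "atom x = atom y" if "(\<lambda>f\<in>F. c f x) = (\<lambda>f\<in>F. c f y)"
    proof -
      have "c f x = c f y" if "f \<in> F" for f
        using fun_cong[OF \<open>(\<lambda>f\<in>F. c f x) = (\<lambda>f\<in>F. c f y)\<close>, of f] that by simp
      then show ?thesis
        by (simp add: atom_def)
    qed
    ultimately show "atom x = atom y \<longleftrightarrow> (\<lambda>f\<in>F. c f x) = (\<lambda>f\<in>F. c f y)"
      by (auto simp: restrict_def fun_eq_iff)
  qed
  finally show ?thesis .
qed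

section \<open>Passage to the group action\<close>

text \<open>Each nonempty member meets some member of a finite subcover and, by disjointness, equals
  it.\<close>

lemma finite_disjoint_open_cover:
  assumes "compact_space T" "open_cover T \<U>" "pairwise disjnt \<U>"
  shows "finite \<U>"
proof -
  obtain \<V> where \<V>: "finite \<V>" "\<V> \<subseteq> \<U>" "topspace T \<subseteq> \<Union>\<V>"
    using assms(1,2) unfolding compact_space_alt open_cover_def by (metis order_refl)
  have "\<U> \<subseteq> insert {} \<V>"
  proof
    fix U assume "U \<in> \<U>"
    show "U \<in> insert {} \<V>"
    proof (cases "U = {}")
      case False
      then obtain x where "x \<in> U"
        by auto
      then obtain V where "V \<in> \<V>" "x \<in> V"
        using \<V>(3) assms(2) \<open>U \<in> \<U>\<close> unfolding open_cover_def by blast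
      then have "V = U"
        using assms(3) \<V>(2) \<open>U \<in> \<U>\<close> \<open>x \<in> U\<close> by (auto simp: pairwise_def disjnt_def)
      then show ?thesis
        using \<open>V \<in> \<V>\<close> by simp
    qed simp
  qed
  then show ?thesis
    using \<V>(1) finite_subset by blast
qed

theorem corollary6p2:
  fixes X :: "'x set" and d :: "'x \<Rightarrow> 'x \<Rightarrow> real"
    and G :: "('g, 'm) monoid_scheme" and \<phi> :: "'g \<Rightarrow> 'x \<Rightarrow> 'x"
    and \<U> :: "'x set set"
  assumes "Metric_space X d"
    and "X \<noteq> {}"
    and "compact_space (Metric_space.mtopology X d)"
    and "group G"
    and "group_action G X \<phi>"
    and "\<And>g. g \<in> carrier G \<Longrightarrow>
      homeomorphic_map (Metric_space.mtopology X d) (Metric_space.mtopology X d) (\<phi> g)"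
    and "open_cover (Metric_space.mtopology X d) \<U>"
    and "pairwise disjnt \<U>"
  shows "\<forall>F\<in>finite_subsets G. \<forall>k\<ge>1. \<forall>Ks. k_cover G k F Ks \<longrightarrow>
    H_top X (cover_power X \<phi> \<U> F)
      \<le> 1 / real k * (\<Sum>i<length Ks. H_top X (cover_power X \<phi> \<U> (Ks ! i)))"
proof (intro ballI allI impI)
  fix F k Ks
  assume F: "F \<in> finite_subsets G" and k: "1 \<le> k" and Ks: "k_cover G k F Ks"
  have space: "topspace (Metric_space.mtopology X d) = X"
    using assms(1) by (rule Metric_space.topspace_mtopology)
  have \<U>: "finite \<U>"
    using assms(3,7,8) by (rule finite_disjoint_open_cover)
  have cover: "\<Union>\<U> = X"
    using assms(7) by (simp add: open_cover_def space)
  have "\<exists>U. U \<in> \<U> \<and> \<phi> f x \<in> U" if "f \<in> carrier G" "x \<in> X" for f x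
  proof -
    have "\<phi> f x \<in> X"
      using homeomorphic_imp_surjective_map[OF assms(6)[OF that(1)]] that(2) by (auto simp: space)
    then show ?thesis
      using cover by blast
  qed
  then obtain c where c: "c f x \<in> \<U> \<and> \<phi> f x \<in> c f x" if "f \<in> carrier G" "x \<in> X" for f x
    by metis
  \<comment> \<open>Members of \<open>Ks\<close> may stick out of \<open>F\<close>. The finite set
    \<open>E\<close> contains them all, so every pattern count is a projection of the single finite
    set \<open>P\<close>, even when \<open>G\<close> is infinite.\<close>
  define E where "E = F \<union> \<Union>(set Ks)"
  define P where "P = (\<lambda>x. \<lambda>f\<in>E. c f x) ` X"
  have K: "K \<subseteq> carrier G" "finite K" "K \<noteq> {}" "K \<subseteq> E" if "K = F \<or> K \<in> set Ks" for K
    using that F Ks by (auto simp: finite_subsets_def k_cover_def E_def)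
  have E: "finite E" "E \<subseteq> carrier G"
    using K unfolding E_def by auto
  have P: "finite P" "P \<noteq> {}"
  proof -
    have "P \<subseteq> PiE E (\<lambda>_. \<U>)"
      using c E by (auto simp: P_def)
    then show "finite P"
      using E \<U> by (meson finite_PiE finite_subset)
    show "P \<noteq> {}"
      using assms(2) by (simp add: P_def)
  qed
  have N: "min_subcover X (cover_power X \<phi> \<U> K) = num_restrictions P K"
    if "K = F \<or> K \<in> set Ks" for K
  proof -
    have "min_subcover X (cover_power X \<phi> \<U> K) = card ((\<lambda>x. \<lambda>f\<in>K. c f x) ` X)"
      using \<U> assms(8) K[OF that] c by (intro min_subcover_cover_power) auto
    also have "(\<lambda>x. \<lambda>f\<in>K. c f x) ` X = (\<lambda>q. restrict q K) ` P"
      using K(4)[OF that] by (simp add: P_def image_image Int_absorb1)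
    finally show ?thesis
      by (simp add: num_restrictions_def)
  qed
  have pos: "0 < num_restrictions P K" for K
    using P by (rule num_restrictions_pos)
  have "real (num_restrictions P F)
      \<le> (\<Prod>i<length Ks. real (num_restrictions P (Ks ! i)) powr (1 / k))"
    using Ks P k K[of F] by (intro Shearer_num_restrictions) (auto simp: k_cover_def)
  \<comment> \<open>Logarithms turn the product bound into the required sum; all counts are positive
    because \<open>P\<close> is nonempty.\<close>
  then have "ln (real (num_restrictions P F))
      \<le> ln (\<Prod>i<length Ks. real (num_restrictions P (Ks ! i)) powr (1 / k))"
    using pos[of F] by (intro ln_mono) auto
  also have "\<dots> = (\<Sum>i<length Ks. ln (real (num_restrictions P (Ks ! i)) powr (1 / k)))"
    using pos by (intro ln_prod) (auto simp: less_imp_neq[symmetric])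
  also have "\<dots> = 1 / real k * (\<Sum>i<length Ks. ln (real (num_restrictions P (Ks ! i))))"
    using pos by (simp add: ln_powr sum_divide_distrib)
  finally show "H_top X (cover_power X \<phi> \<U> F)
      \<le> 1 / real k * (\<Sum>i<length Ks. H_top X (cover_power X \<phi> \<U> (Ks ! i)))"
    by (simp add: H_top_def N)
qed

end
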